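(* Let $(\mathcal{X},\mathcal{A},L)$ be a basic game. Let $\Gamma\subseteq\mathcal{P}$ be convex, and let $P^*\in\Gamma$, with Bayes act $\zeta^*\in\mathcal{Z}$, be such that $-\infty<H(P^* )=H^*:=\sup_{P\in\Gamma}H(P)<\infty$. Suppose that for all $P\in\Gamma$ there exists $P_0\in\mathcal{P}$ such that, on defining $Q_\lambda:=(1-\lambda)P_0+\lambda P$, the following hold: (i) $P^*=Q_{\lambda^*}$ for some $\lambda^*\in(0,1)$; (ii) the function $\lambda\mapsto H(Q_\lambda)$ is differentiable at $\lambda=\lambda^*$. Then $(P^*,\zeta^* )$ is a saddle-point in $\mathcal{G}^\Gamma=(\Gamma,\mathcal{A},L)$.
   Context: A basic game $(\mathcal{X},\mathcal{A},L)$ consists of measurable spaces $\mathcal{X}$ and $\mathcal{A}$ (with $\sigma$-fields containing all singletons; here $\mathcal{X}$ is a metric space with its Borel $\sigma$-algebra) and a jointly measurable loss function $L:\mathcal{X}\times\mathcal{A}\to(-\infty,\infty]$. Expectations are taken in the extended sense $E f=E f^+-E f^-$, defined unless both terms are infinite. $L(P,a):=E_P\{L(X,a)\}$, and $\mathcal{P}$ is the set of all probability distributions $P$ on $\mathcal{X}$ such that $L(P,a)$ is defined for all $a\in\mathcal{A}$. For a randomized act $\zeta$ (a probability distribution on $\mathcal{A}$), $L(x,\zeta):=E_{A\sim\zeta}\{L(x,A)\}$ and $L(P,\zeta):=E_{(X,A)\sim P\times\zeta}\{L(X,A)\}$; $\mathcal{Z}$ is the set of all $\zeta$ such that $L(P,\zeta)$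 is defined for all $P\in\mathcal{P}$. An act $\zeta_P\in\mathcal{Z}$ is Bayes against $P$ if $E_P\{L(X,\zeta)-L(X,\zeta_P)\}\in[0,\infty]$ for all $\zeta\in\mathcal{Z}$. The generalized entropy is $H(P):=\inf_{a\in\mathcal{A}}L(P,a)$. A pair $(P^*,\zeta^* )\in\Gamma\times\mathcal{Z}$ is a saddle-point in $\mathcal{G}^\Gamma$ if $L(P^*,\zeta^* )$ is finite, $L(P^*,\zeta^* )\le L(P^*,\zeta)$ for all $\zeta\in\mathcal{Z}$, and $L(P^*,\zeta^* )\ge L(P,\zeta^* )$ for all $P\in\Gamma$. *)

theory Defs
  imports "HOL-Probability.Probability"
begin

text \<open>
  Expectation in the extended sense, \<open>E f = E f\<^sup>+ - E f\<^sup>-\<close>; \<open>e2ennreal\<close> sends negative values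
  to \<open>0\<close>. The value of \<open>ext_expectation\<close> is
  meaningful only under \<open>ext_defined\<close>: ereal subtraction would otherwise return
  \<open>\<infinity> - \<infinity> = \<infinity>\<close>.
\<close>

definition ext_defined :: "'b measure \<Rightarrow> ('b \<Rightarrow> ereal) \<Rightarrow> bool" where
  "ext_defined M f \<longleftrightarrow>
     \<not> ((\<integral>\<^sup>+ x. e2ennreal (f x) \<partial>M) = \<infinity> \<and> (\<integral>\<^sup>+ x. e2ennreal (- f x) \<partial>M) = \<infinity>)"

definition ext_expectation :: "'b measure \<Rightarrow> ('b \<Rightarrow> ereal) \<Rightarrow> ereal" where
  "ext_expectation M f =
     enn2ereal (\<integral>\<^sup>+ x. e2ennreal (f x) \<partial>M) - enn2ereal (\<integral>\<^sup>+ x. e2ennreal (- f x) \<partial>M)"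

definition distributions :: "'b measure \<Rightarrow> 'b measure set" where
  "distributions M = {P. prob_space P \<and> sets P = sets M}"

locale basic_game =
  fixes X :: "'x measure" and A :: "'a measure" and L :: "'x \<Rightarrow> 'a \<Rightarrow> ereal"
  assumes singletons_X: "\<And>x. x \<in> space X \<Longrightarrow> {x} \<in> sets X"
    and singletons_A: "\<And>a. a \<in> space A \<Longrightarrow> {a} \<in> sets A"
    and measurable_L: "(\<lambda>(x, a). L x a) \<in> borel_measurable (X \<Otimes>\<^sub>M A)"
    and L_not_MInf: "\<And>x a. x \<in> space X \<Longrightarrow> a \<in> space A \<Longrightarrow> L x a \<noteq> - \<infinity>"

definition exp_loss :: "('x \<Rightarrow> 'a \<Rightarrow> ereal) \<Rightarrow> 'x measure \<Rightarrow> 'a \<Rightarrow> ereal" where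
  "exp_loss L P a = ext_expectation P (\<lambda>x. L x a)"

definition admissible_dists ::
    "'x measure \<Rightarrow> 'a measure \<Rightarrow> ('x \<Rightarrow> 'a \<Rightarrow> ereal) \<Rightarrow> 'x measure set" where
  "admissible_dists X A L =
     {P \<in> distributions X. \<forall>a\<in>space A. ext_defined P (\<lambda>x. L x a)}"

text \<open>For \<open>\<zeta>\<close> in \<open>randomized_acts X A L\<close> the expectation \<open>L(x,\<zeta>)\<close>
  is defined for every \<open>x\<close>, because \<open>admissible_dists X A L\<close> contains all point masses.\<close>

definition rand_loss :: "('x \<Rightarrow> 'a \<Rightarrow> ereal) \<Rightarrow> 'x \<Rightarrow> 'a measure \<Rightarrow> ereal" where
  "rand_loss L x \<zeta> = ext_expectation \<zeta> (\<lambda>a. L x a)"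

definition exp_rand_loss ::
    "('x \<Rightarrow> 'a \<Rightarrow> ereal) \<Rightarrow> 'x measure \<Rightarrow> 'a measure \<Rightarrow> ereal" where
  "exp_rand_loss L P \<zeta> = ext_expectation (P \<Otimes>\<^sub>M \<zeta>) (\<lambda>(x, a). L x a)"

definition randomized_acts ::
    "'x measure \<Rightarrow> 'a measure \<Rightarrow> ('x \<Rightarrow> 'a \<Rightarrow> ereal) \<Rightarrow> 'a measure set" where
  "randomized_acts X A L =
     {\<zeta> \<in> distributions A.
        \<forall>P\<in>admissible_dists X A L. ext_defined (P \<Otimes>\<^sub>M \<zeta>) (\<lambda>(x, a). L x a)}"

text \<open>
  The requirement \<open>E\<^sub>P{L(X,\<zeta>) - L(X,\<zeta>\<^sub>P)} \<in> [0,\<infinity>]\<close> includes that the expectation exists: the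
  difference must not be of the form \<open>\<infinity> - \<infinity>\<close> or \<open>(-\<infinity>) - (-\<infinity>)\<close> except on a \<open>P\<close>-null set, and
  its extended expectation must be defined.
\<close>

definition diff_defined :: "ereal \<Rightarrow> ereal \<Rightarrow> bool" where
  "diff_defined u v \<longleftrightarrow> \<not> (u = v \<and> \<bar>u\<bar> = \<infinity>)"

definition bayes_act ::
    "'x measure \<Rightarrow> 'a measure \<Rightarrow> ('x \<Rightarrow> 'a \<Rightarrow> ereal) \<Rightarrow> 'x measure \<Rightarrow> 'a measure \<Rightarrow> bool" where
  "bayes_act X A L P \<zeta>\<^sub>P \<longleftrightarrow>
     \<zeta>\<^sub>P \<in> randomized_acts X A L \<and>
     (\<forall>\<zeta>\<in>randomized_acts X A L.
        (AE x in P. diff_defined (rand_loss L x \<zeta>) (rand_loss L x \<zeta>\<^sub>P)) \<and>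
        ext_defined P (\<lambda>x. rand_loss L x \<zeta> - rand_loss L x \<zeta>\<^sub>P) \<and>
        0 \<le> ext_expectation P (\<lambda>x. rand_loss L x \<zeta> - rand_loss L x \<zeta>\<^sub>P))"

definition gen_entropy ::
    "'a measure \<Rightarrow> ('x \<Rightarrow> 'a \<Rightarrow> ereal) \<Rightarrow> 'x measure \<Rightarrow> ereal" where
  "gen_entropy A L P = (INF a\<in>space A. exp_loss L P a)"

text \<open>\<open>mixture \<lambda> P\<^sub>0 P\<close> is \<open>(1 - \<lambda>) P\<^sub>0 + \<lambda> P\<close>, meaningful only for \<open>\<lambda> \<in> [0,1]\<close> and
  distributions on the same space.\<close>

definition mixture :: "real \<Rightarrow> 'b measure \<Rightarrow> 'b measure \<Rightarrow> 'b measure" where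
  "mixture l P\<^sub>0 P =
     measure_of (space P\<^sub>0) (sets P\<^sub>0)
       (\<lambda>S. ennreal (1 - l) * emeasure P\<^sub>0 S + ennreal l * emeasure P S)"

definition convex_dists :: "'b measure set \<Rightarrow> bool" where
  "convex_dists \<Gamma> \<longleftrightarrow> (\<forall>P\<in>\<Gamma>. \<forall>Q\<in>\<Gamma>. \<forall>l\<in>{0..1}. mixture l P Q \<in> \<Gamma>)"

text \<open>Differentiability of an extended-real-valued function of a real variable: it is finite near
  the point and differentiable there as a real-valued function.\<close>

definition ereal_differentiable_at :: "(real \<Rightarrow> ereal) \<Rightarrow> real \<Rightarrow> bool" where
  "ereal_differentiable_at f l \<longleftrightarrow>
     (\<forall>\<^sub>F x in nhds l. \<bar>f x\<bar> \<noteq> \<infinity>) \<and> (\<lambda>x. real_of_ereal (f x)) differentiable (at l)"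

definition saddle_point ::
    "'x measure \<Rightarrow> 'a measure \<Rightarrow> ('x \<Rightarrow> 'a \<Rightarrow> ereal) \<Rightarrow> 'x measure set \<Rightarrow>
     'x measure \<Rightarrow> 'a measure \<Rightarrow> bool" where
  "saddle_point X A L \<Gamma> P\<^sub>s \<zeta>\<^sub>s \<longleftrightarrow>
     P\<^sub>s \<in> \<Gamma> \<and> \<zeta>\<^sub>s \<in> randomized_acts X A L \<and>
     \<bar>exp_rand_loss L P\<^sub>s \<zeta>\<^sub>s\<bar> \<noteq> \<infinity> \<and>
     (\<forall>\<zeta>\<in>randomized_acts X A L. exp_rand_loss L P\<^sub>s \<zeta>\<^sub>s \<le> exp_rand_loss L P\<^sub>s \<zeta>) \<and>
     (\<forall>P\<in>\<Gamma>. exp_rand_loss L P \<zeta>\<^sub>s \<le> exp_rand_loss L P\<^sub>s \<zeta>\<^sub>s)"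

end

theory Submission imports Defs begin

text \<open>
  By Fubini, \<open>H(P) \<le> L(P,\<zeta>)\<close> for every randomized act \<open>\<zeta>\<close>; comparing \<open>\<zeta>\<^sup>*\<close> with the pure acts gives
  the equality \<open>L(P\<^sup>*,\<zeta>\<^sup>*) = H(P\<^sup>*)\<close>. Along the segment \<open>Q\<^sub>\<lambda>\<close> the affine function
  \<open>\<lambda> \<mapsto> L(Q\<^sub>\<lambda>,\<zeta>\<^sup>*)\<close> therefore touches \<open>H(Q\<^sub>\<lambda>)\<close> from above at \<open>\<lambda>\<^sup>*\<close>, so its slope is the
  derivative of the entropy there. This derivative is at most \<open>0\<close> because \<open>Q\<^sub>\<lambda>\<close> lies in \<open>\<Gamma>\<close> for
  \<open>\<lambda>\<^sup>* \<le> \<lambda> \<le> 1\<close>, and hence \<open>L(P,\<zeta>\<^sup>*) \<le> L(P\<^sup>*,\<zeta>\<^sup>*)\<close>.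
\<close>

section \<open>Subtraction-free arithmetic for differences of extended nonnegative numbers\<close>

text \<open>Both sides hold if \<open>p = \<infinity>\<close>, in keeping with \<open>\<infinity> - \<infinity> = \<infinity>\<close> in \<^typ>\<open>ereal\<close>.\<close>

lemma ereal_le_enn2ereal_diff_iff:
  "ereal c \<le> enn2ereal p - enn2ereal n \<longleftrightarrow> n + ennreal c \<le> p + ennreal (- c)"
proof (cases p; cases n)
  fix r s :: real
  assume *: "0 \<le> r" "p = ennreal r" "0 \<le> s" "n = ennreal s"
  show ?thesis
  proof (cases "0 \<le> c")
    case True
    then show ?thesis
      using * by (auto simp: enn2ereal_ennreal ennreal_neg ennreal_plus[symmetric] simp del: ennreal_plus)
  next
    case False
    then show ?thesis
      using * by (auto simp: enn2ereal_ennreal ennreal_neg ennreal_plus[symmetric] simp del: ennreal_plus)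
  qed
qed (auto simp: enn2ereal_ennreal top_unique)

lemma zero_le_enn2ereal_diffD:
  assumes "0 \<le> enn2ereal p - enn2ereal n" "\<not> (p = \<infinity> \<and> n = \<infinity>)"
  shows "n < \<infinity>" "n \<le> p"
  using assms ereal_le_enn2ereal_diff_iff[of 0 p n] by (auto simp: top.not_eq_extremum zero_ereal_def)

text \<open>This is \<open>d = u - (p - n)\<close> with \<open>d\<close> and \<open>u\<close> split
  into positive and negative parts and every term moved to the side where it is added. In this form
  it can be integrated term by term in \<open>ennreal\<close>. An infinite \<open>p\<close> or
  \<open>n\<close> makes both sides infinite, so the content lies in the finite case.\<close>

lemma ennreal_parts_diff_identity:
  assumes "\<bar>u\<bar> \<noteq> \<infinity>"
  shows "e2ennreal (u - (enn2ereal p - enn2ereal n)) + p + e2ennreal (- u) =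
         e2ennreal (- (u - (enn2ereal p - enn2ereal n))) + e2ennreal u + n"
proof -
  obtain r where u: "u = ereal r" using assms by auto
  show ?thesis
  proof (cases p; cases n)
    fix a b :: real
    assume *: "0 \<le> a" "p = ennreal a" "0 \<le> b" "n = ennreal b"
    have diff: "u - (enn2ereal p - enn2ereal n) = ereal (r - (a - b))"
      using * by (simp add: u enn2ereal_ennreal)
    have id: "max 0 (r - (a - b)) + a + max 0 (- r) = max 0 (- (r - (a - b))) + max 0 r + b"
      by (cases "0 \<le> r"; cases "0 \<le> r - (a - b)") (simp_all add: max_def)
    have "e2ennreal (ereal x) = ennreal (max 0 x)" for x
      by (cases "0 \<le> x") (simp_all add: ennreal_neg)
    then show ?thesis
      using * arg_cong[OF id, of ennreal] unfolding diff
      by (simp add: u ennreal_plus)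
  qed (auto simp: u enn2ereal_ennreal)
qed

text \<open>Intended for the integrated form of the preceding identity: cancelling
  \<open>dn \<le> dp\<close> leaves \<open>p + un \<le> up + n\<close>. If \<open>n\<close> is
  infinite, then \<open>p\<close> is finite and the left-hand difference is
  \<open>-\<infinity>\<close>. Otherwise the right side of \<open>bal\<close> is finite, which
  forces \<open>dp\<close> and \<open>p\<close> to be finite, and real arithmetic applies.\<close>

lemma ennreal_balance_le:
  fixes dp dn up un p n :: ennreal
  assumes bal: "dp + p + un = dn + up + n" and "\<not> (p = \<infinity> \<and> n = \<infinity>)"
    and "dn < \<infinity>" "dn \<le> dp" "up \<noteq> \<infinity>" "un \<noteq> \<infinity>"
  shows "enn2ereal p - enn2ereal n \<le> enn2ereal up - enn2ereal un"
proof (cases "n = \<infinity>")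
  case True
  then show ?thesis
    using assms(2) by (cases p) (auto simp: enn2ereal_ennreal)
next
  case False
  then have "dn + up + n < \<infinity>"
    using assms by (simp add: top.not_eq_extremum)
  then have "dp + p + un < \<infinity>"
    by (simp add: bal)
  then have fin: "dp \<noteq> \<infinity>" "p \<noteq> \<infinity>"
    by (auto simp: top.not_eq_extremum)
  have real: "\<exists>r\<ge>0. x = ennreal r" if "x \<noteq> \<infinity>" for x
    using that by (cases x) auto
  obtain a b c d e f where *: "0 \<le> a" "0 \<le> b" "0 \<le> c" "0 \<le> d" "0 \<le> e" "0 \<le> f"
    and eqs: "dp = ennreal a" "dn = ennreal b" "up = ennreal c" "un = ennreal d"
      "p = ennreal e" "n = ennreal f"
    using real[of dp] real[of dn] real[of up] real[of un] real[of p] real[of n] assms False fin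
    by (auto simp: top.not_eq_extremum)
  have "ennreal (a + e + d) = ennreal (b + c + f)"
    using bal * by (simp add: eqs)
  then have "a + e + d = b + c + f"
    using * by (subst (asm) ennreal_inj) auto
  moreover have "b \<le> a"
    using \<open>dn \<le> dp\<close> * by (simp add: eqs)
  ultimately show ?thesis
    using * by (simp add: eqs enn2ereal_ennreal)
qed

section \<open>Mixtures of distributions and integration against them\<close>

lemma sets_mixture [simp]: "sets (mixture t P Q) = sets P"
  by (simp add: mixture_def sets.space_closed)

lemma space_mixture [simp]: "space (mixture t P Q) = space P"
  by (simp add: mixture_def sets.space_closed)

lemma emeasure_mixture:
  assumes "sets Q = sets P" "S \<in> sets P"
  shows "emeasure (mixture t P Q) S = ennreal (1 - t) * emeasure P S + ennreal t * emeasure Q S"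
proof (rule emeasure_measure_of[OF mixture_def])
  show "countably_additive (sets (mixture t P Q))
     (\<lambda>S. ennreal (1 - t) * emeasure P S + ennreal t * emeasure Q S)"
    by (rule countably_additiveI)
      (simp add: suminf_add[symmetric] suminf_emeasure assms(1))
qed (use assms in \<open>auto simp: positive_def sets.space_closed dest: sets.sets_into_space\<close>)

lemma prob_space_mixture:
  assumes "prob_space P" "prob_space Q" "sets Q = sets P" "0 \<le> t" "t \<le> 1"
  shows "prob_space (mixture t P Q)"
proof
  interpret P: prob_space P by fact
  interpret Q: prob_space Q by fact
  have "emeasure Q (space P) = 1"
    using Q.emeasure_space_1 sets_eq_imp_space_eq[OF assms(3)] by simp
  then show "emeasure (mixture t P Q) (space (mixture t P Q)) = 1"
    using assms by (simp add: emeasure_mixture P.emeasure_space_1 ennreal_plus[symmetric] del: ennreal_plus)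
qed

text \<open>Reparametrizes the part of the segment between the mixture at \<open>l\<close> and the
  endpoint \<open>Q\<close>. Convexity can then be applied to those two distributions even when
  \<open>P\<close> lies outside the convex set.\<close>

lemma mixture_mixture:
  assumes "sets Q = sets P" "l < 1" "0 \<le> l" "l \<le> t" "t \<le> 1"
  shows "mixture ((t - l) / (1 - l)) (mixture l P Q) Q = mixture t P Q"
proof (rule measure_eqI)
  define s where "s = (t - l) / (1 - l)"
  have sl: "s * (1 - l) = t - l"
    using assms by (simp add: s_def)
  \<comment> \<open>The choice of \<open>s\<close> makes the weights of \<open>P\<close> agree; the
    weights of \<open>Q\<close> then agree because both pairs sum to one.\<close>
  have s: "0 \<le> s" "s \<le> 1" "(1 - s) * (1 - l) = 1 - t" "(1 - s) * l + s = t"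
    using assms sl by (simp add: s_def, simp add: s_def divide_le_eq, simp_all add: algebra_simps)
  fix S assume "S \<in> sets (mixture ((t - l) / (1 - l)) (mixture l P Q) Q)"
  then have S: "S \<in> sets P" by simp
  have "emeasure (mixture s (mixture l P Q) Q) S =
      ennreal (1 - s) * (ennreal (1 - l) * emeasure P S + ennreal l * emeasure Q S)
      + ennreal s * emeasure Q S"
    using S assms by (simp add: emeasure_mixture)
  also have "\<dots> = (ennreal (1 - s) * ennreal (1 - l)) * emeasure P S
      + (ennreal (1 - s) * ennreal l + ennreal s) * emeasure Q S"
    by (simp only: distrib_left distrib_right mult.assoc add.assoc)
  also have "ennreal (1 - s) * ennreal (1 - l) = ennreal (1 - t)"
    using s(1,2) assms by (simp flip: ennreal_mult s(3))
  also have "ennreal (1 - s) * ennreal l + ennreal s = ennreal t"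
    using s(1,2) assms by (subst s(4)[symmetric]) (simp add: ennreal_mult)
  also have "ennreal (1 - t) * emeasure P S + ennreal t * emeasure Q S = emeasure (mixture t P Q) S"
    using S assms(1) by (simp add: emeasure_mixture)
  finally show "emeasure (mixture ((t - l) / (1 - l)) (mixture l P Q) Q) S = emeasure (mixture t P Q) S"
    by (simp add: s_def)
qed simp

lemma nn_integral_mixture:
  assumes Q: "sets Q = sets P" and "f \<in> borel_measurable P"
  shows "(\<integral>\<^sup>+ x. f x \<partial>mixture t P Q) =
    ennreal (1 - t) * (\<integral>\<^sup>+ x. f x \<partial>P) + ennreal t * (\<integral>\<^sup>+ x. f x \<partial>Q)"
  using assms(2)
proof induction
  note [measurable_cong] = Q sets_mixture[of t P Q]
  {
    case (cong f g)
    then show ?case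
      using sets_eq_imp_space_eq[OF Q] by (simp cong: nn_integral_cong_simp)
  next
    case (set S)
    then show ?case by (simp add: Q emeasure_mixture)
  next
    case (mult u c)
    then show ?case
      by (subst (1 2 3) nn_integral_cmult) (auto simp: distrib_left mult.left_commute)
  next
    case (add u v)
    then show ?case
      by (subst (1 2 3) nn_integral_add) (auto simp: distrib_left ac_simps)
  next
    case (seq U)
    have [measurable]: "\<And>i. U i \<in> borel_measurable P" by fact
    \<comment> \<open>Both sequences must increase for the sum of their suprema to be the supremum
      of their sums.\<close>
    have mono: "incseq (\<lambda>i. c * (\<integral>\<^sup>+ x. U i x \<partial>M))" for c M
      using seq(3) by (auto simp: incseq_def le_fun_def intro!: mult_left_mono nn_integral_mono)
    have "(\<integral>\<^sup>+ x. (SUP i. U i x) \<partial>mixture t P Q) =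
        (SUP i. ennreal (1 - t) * (\<integral>\<^sup>+ x. U i x \<partial>P) + ennreal t * (\<integral>\<^sup>+ x. U i x \<partial>Q))"
      using seq by (subst nn_integral_monotone_convergence_SUP) auto
    also have "\<dots> = ennreal (1 - t) * (\<integral>\<^sup>+ x. (SUP i. U i x) \<partial>P)
        + ennreal t * (\<integral>\<^sup>+ x. (SUP i. U i x) \<partial>Q)"
      using seq by (subst (1 2) nn_integral_monotone_convergence_SUP)
        (auto simp: SUP_mult_left_ennreal ennreal_SUP_add[OF mono mono])
    finally show ?case by (simp add: image_comp)
  }
qed

text \<open>Integrating over \<open>Z\<close> first leaves a function on the first factor alone, to
  which the one-variable formula applies.\<close>

lemma nn_integral_mixture_pair:
  assumes "sets Q = sets P" "sigma_finite_measure Z" "f \<in> borel_measurable (P \<Otimes>\<^sub>M Z)"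
  shows "(\<integral>\<^sup>+ z. f z \<partial>(mixture t P Q \<Otimes>\<^sub>M Z)) =
    ennreal (1 - t) * (\<integral>\<^sup>+ z. f z \<partial>(P \<Otimes>\<^sub>M Z)) + ennreal t * (\<integral>\<^sup>+ z. f z \<partial>(Q \<Otimes>\<^sub>M Z))"
proof -
  interpret Z: sigma_finite_measure Z by fact
  have f: "f \<in> borel_measurable (mixture t P Q \<Otimes>\<^sub>M Z)" "f \<in> borel_measurable (Q \<Otimes>\<^sub>M Z)"
    using assms(3) by (simp_all cong: measurable_cong_sets sets_pair_measure_cong add: assms(1))
  show ?thesis
    using Z.borel_measurable_nn_integral_fst[OF assms(3)]
    by (simp add: Z.nn_integral_fst[symmetric] f assms(3) nn_integral_mixture[OF assms(1)])
qed

section \<open>Extended expectations under product measures\<close>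

text \<open>At an interior \<open>l\<close> both weights are positive, so one finite value there
  forces the positive and negative parts of \<open>f\<close> to have finite integrals under both
  endpoints. Linearity then holds in the reals on the whole segment, with \<open>u\<close> and
  \<open>v\<close> the expectations at the endpoints.\<close>

lemma ext_expectation_mixture_pair_affine:
  fixes f :: "'x \<times> 'a \<Rightarrow> ereal"
  assumes Q: "sets Q = sets P" and Z: "sigma_finite_measure Z"
    and f [measurable]: "f \<in> borel_measurable (P \<Otimes>\<^sub>M Z)" and l: "0 < l" "l < 1"
    and fin: "\<bar>ext_expectation (mixture l P Q \<Otimes>\<^sub>M Z) f\<bar> \<noteq> \<infinity>"
  obtains u v where "ext_expectation (Q \<Otimes>\<^sub>M Z) f = ereal v"
    "\<And>t. 0 \<le> t \<Longrightarrow> t \<le> 1 \<Longrightarrow>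
      ext_expectation (mixture t P Q \<Otimes>\<^sub>M Z) f = ereal ((1 - t) * u + t * v)"
proof -
  define pos where "pos M = (\<integral>\<^sup>+ z. e2ennreal (f z) \<partial>(M \<Otimes>\<^sub>M Z))" for M
  define neg where "neg M = (\<integral>\<^sup>+ z. e2ennreal (- f z) \<partial>(M \<Otimes>\<^sub>M Z))" for M
  have ext: "ext_expectation (M \<Otimes>\<^sub>M Z) f = enn2ereal (pos M) - enn2ereal (neg M)" for M
    by (simp add: ext_expectation_def pos_def neg_def)
  have pos: "pos (mixture t P Q) = ennreal (1 - t) * pos P + ennreal t * pos Q" for t
    unfolding pos_def by (rule nn_integral_mixture_pair[OF Q Z]) measurable
  have neg: "neg (mixture t P Q) = ennreal (1 - t) * neg P + ennreal t * neg Q" for t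
    unfolding neg_def by (rule nn_integral_mixture_pair[OF Q Z]) measurable
  \<comment> \<open>An infinite positive part would give the value \<open>\<infinity>\<close>
    whatever the negative part is, since \<open>\<infinity> - \<infinity> = \<infinity>\<close> in
    \<open>ereal\<close>.\<close>
  have posfin: "pos (mixture l P Q) \<noteq> \<infinity>"
    using fin unfolding ext by auto
  moreover have "neg (mixture l P Q) \<noteq> \<infinity>"
    using fin posfin unfolding ext by (cases "pos (mixture l P Q)") (auto simp: enn2ereal_ennreal)
  ultimately have "pos P \<noteq> \<infinity>" "pos Q \<noteq> \<infinity>" "neg P \<noteq> \<infinity>" "neg Q \<noteq> \<infinity>"
    using l by (auto simp: pos neg ennreal_mult_eq_top_iff)
  then obtain pP pQ nP nQ where r: "0 \<le> pP" "0 \<le> pQ" "0 \<le> nP" "0 \<le> nQ"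
    "pos P = ennreal pP" "pos Q = ennreal pQ" "neg P = ennreal nP" "neg Q = ennreal nQ"
    by (metis ennreal_cases infinity_ennreal_def)
  show ?thesis
  proof (rule that[of "pQ - nQ" "pP - nP"])
    show "ext_expectation (Q \<Otimes>\<^sub>M Z) f = ereal (pQ - nQ)"
      using r by (simp add: ext enn2ereal_ennreal)
    show "ext_expectation (mixture t P Q \<Otimes>\<^sub>M Z) f =
        ereal ((1 - t) * (pP - nP) + t * (pQ - nQ))" if "0 \<le> t" "t \<le> 1" for t
    proof -
      have "enn2ereal (pos (mixture t P Q)) = ereal ((1 - t) * pP + t * pQ)"
        "enn2ereal (neg (mixture t P Q)) = ereal ((1 - t) * nP + t * nQ)"
        using r that by (simp_all add: pos neg enn2ereal_ennreal flip: ennreal_mult ennreal_plus)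
      then show ?thesis
        by (simp add: ext algebra_simps)
    qed
  qed
qed

text \<open>For each \<open>a\<close> the bound is rewritten as an inequality between sums of
  nonnegative terms, integrated over \<open>Z\<close>, and converted back. Tonelli identifies the
  iterated integrals, and the constants survive because \<open>Z\<close> has mass one.\<close>

lemma ext_expectation_pair_ge:
  fixes f :: "'x \<times> 'a \<Rightarrow> ereal"
  assumes "sigma_finite_measure P" "prob_space Z"
    and f [measurable]: "f \<in> borel_measurable (P \<Otimes>\<^sub>M Z)"
    and ge: "\<And>a. a \<in> space Z \<Longrightarrow> ereal c \<le> ext_expectation P (\<lambda>x. f (x, a))"
  shows "ereal c \<le> ext_expectation (P \<Otimes>\<^sub>M Z) f"
proof -
  interpret Z: prob_space Z by fact
  interpret P: sigma_finite_measure P by fact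
  interpret pair_sigma_finite P Z ..
  have "(\<integral>\<^sup>+ a. (\<integral>\<^sup>+ x. e2ennreal (- f (x, a)) \<partial>P) + ennreal c \<partial>Z)
      \<le> (\<integral>\<^sup>+ a. (\<integral>\<^sup>+ x. e2ennreal (f (x, a)) \<partial>P) + ennreal (- c) \<partial>Z)"
    using ge by (intro nn_integral_mono)
      (simp add: ext_expectation_def ereal_le_enn2ereal_diff_iff)
  then have "(\<integral>\<^sup>+ a. \<integral>\<^sup>+ x. e2ennreal (- f (x, a)) \<partial>P \<partial>Z) + ennreal c
      \<le> (\<integral>\<^sup>+ a. \<integral>\<^sup>+ x. e2ennreal (f (x, a)) \<partial>P \<partial>Z) + ennreal (- c)"
    by (simp add: nn_integral_add Z.emeasure_space_1)
  moreover have "(\<integral>\<^sup>+ a. \<integral>\<^sup>+ x. e2ennreal (- f (x, a)) \<partial>P \<partial>Z)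
      = (\<integral>\<^sup>+ z. e2ennreal (- f z) \<partial>(P \<Otimes>\<^sub>M Z))"
    by (rule nn_integral_snd) measurable
  moreover have "(\<integral>\<^sup>+ a. \<integral>\<^sup>+ x. e2ennreal (f (x, a)) \<partial>P \<partial>Z)
      = (\<integral>\<^sup>+ z. e2ennreal (f z) \<partial>(P \<Otimes>\<^sub>M Z))"
    by (rule nn_integral_snd) measurable
  ultimately show ?thesis
    by (simp add: ext_expectation_def ereal_le_enn2ereal_diff_iff)
qed

text \<open>Linearity of expectation in the presence of infinite values: \<open>u\<close> plays the
  loss of a competing act, and the inner expectation of \<open>f\<close> the loss of the randomized
  act. Finiteness of the expectation of \<open>u\<close> permits the cancellation.\<close>

lemma ext_expectation_pair_le:
  fixes f :: "'x \<times> 'a \<Rightarrow> ereal" and u :: "'x \<Rightarrow> ereal"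
  assumes "sigma_finite_measure P" "sigma_finite_measure Z"
    and f [measurable]: "f \<in> borel_measurable (P \<Otimes>\<^sub>M Z)" and u [measurable]: "u \<in> borel_measurable P"
    and u_fin: "\<bar>ext_expectation P u\<bar> \<noteq> \<infinity>"
    and f_defined: "ext_defined (P \<Otimes>\<^sub>M Z) f"
    and d_defined: "ext_defined P (\<lambda>x. u x - ext_expectation Z (\<lambda>a. f (x, a)))"
    and d_ge: "0 \<le> ext_expectation P (\<lambda>x. u x - ext_expectation Z (\<lambda>a. f (x, a)))"
  shows "ext_expectation (P \<Otimes>\<^sub>M Z) f \<le> ext_expectation P u"
proof -
  interpret Z: sigma_finite_measure Z by fact
  define p where "p x = (\<integral>\<^sup>+ a. e2ennreal (f (x, a)) \<partial>Z)" for x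
  define n where "n x = (\<integral>\<^sup>+ a. e2ennreal (- f (x, a)) \<partial>Z)" for x
  define d where "d x = u x - (enn2ereal (p x) - enn2ereal (n x))" for x
  have [measurable]: "p \<in> borel_measurable P" "n \<in> borel_measurable P"
    unfolding p_def n_def by measurable
  have [measurable]: "d \<in> borel_measurable P"
    unfolding d_def by measurable
  have p: "integral\<^sup>N P p = (\<integral>\<^sup>+ z. e2ennreal (f z) \<partial>(P \<Otimes>\<^sub>M Z))"
    unfolding p_def by (rule Z.nn_integral_fst) measurable
  have n: "integral\<^sup>N P n = (\<integral>\<^sup>+ z. e2ennreal (- f z) \<partial>(P \<Otimes>\<^sub>M Z))"
    unfolding n_def by (rule Z.nn_integral_fst) measurable
  have d: "(\<lambda>x. u x - ext_expectation Z (\<lambda>a. f (x, a))) = d"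
    by (simp add: fun_eq_iff d_def p_def n_def ext_expectation_def)
  have dp: "ext_defined P d" "0 \<le> ext_expectation P d"
    using d_defined d_ge by (simp_all only: d)
  \<comment> \<open>A defined, nonnegative expectation means that the negative part of
    \<open>d\<close> has a finite integral, at most that of its positive part.\<close>
  note dn = zero_le_enn2ereal_diffD[OF dp(2)[unfolded ext_expectation_def] dp(1)[unfolded ext_defined_def]]
  have up: "(\<integral>\<^sup>+ x. e2ennreal (u x) \<partial>P) \<noteq> \<infinity>"
    using u_fin by (auto simp: ext_expectation_def)
  moreover have un: "(\<integral>\<^sup>+ x. e2ennreal (- u x) \<partial>P) \<noteq> \<infinity>"
    using u_fin up by (cases "\<integral>\<^sup>+ x. e2ennreal (u x) \<partial>P") (auto simp: ext_expectation_def enn2ereal_ennreal)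
  ultimately have "AE x in P. e2ennreal (u x) \<noteq> \<infinity>" "AE x in P. e2ennreal (- u x) \<noteq> \<infinity>"
    by (intro nn_integral_noteq_infinite; simp)+
  \<comment> \<open>Integrable parts make \<open>u\<close> finite almost everywhere, as the
    pointwise identity for \<open>d\<close> requires.\<close>
  then have "AE x in P. \<bar>u x\<bar> \<noteq> \<infinity>"
    by eventually_elim auto
  then have "AE x in P. e2ennreal (d x) + p x + e2ennreal (- u x) = e2ennreal (- d x) + e2ennreal (u x) + n x"
    by eventually_elim (simp add: d_def ennreal_parts_diff_identity)
  then have "(\<integral>\<^sup>+ x. e2ennreal (d x) + p x + e2ennreal (- u x) \<partial>P)
      = (\<integral>\<^sup>+ x. e2ennreal (- d x) + e2ennreal (u x) + n x \<partial>P)"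
    by (rule nn_integral_cong_AE)
  then have "(\<integral>\<^sup>+ x. e2ennreal (d x) \<partial>P) + integral\<^sup>N P p + (\<integral>\<^sup>+ x. e2ennreal (- u x) \<partial>P)
      = (\<integral>\<^sup>+ x. e2ennreal (- d x) \<partial>P) + (\<integral>\<^sup>+ x. e2ennreal (u x) \<partial>P) + integral\<^sup>N P n"
    by (simp add: nn_integral_add)
  moreover have "\<not> (integral\<^sup>N P p = \<infinity> \<and> integral\<^sup>N P n = \<infinity>)"
    using f_defined by (simp add: ext_defined_def p n)
  ultimately have "enn2ereal (integral\<^sup>N P p) - enn2ereal (integral\<^sup>N P n) \<le> ext_expectation P u"
    using dn up un unfolding ext_expectation_def by (intro ennreal_balance_le)
  then show ?thesis
    by (simp add: ext_expectation_def p n)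
qed

section \<open>Pure acts, entropy and Bayes acts\<close>

text \<open>Integrating out the point mass reduces definedness on the product to definedness of the
  expected loss of \<open>a\<close>, which is part of the definition of
  \<open>admissible_dists\<close>.\<close>

lemma return_in_randomized_acts:
  assumes a: "a \<in> space A" and L: "(\<lambda>(x, a). L x a) \<in> borel_measurable (X \<Otimes>\<^sub>M A)"
  shows "return A a \<in> randomized_acts X A L"
proof -
  have prob: "prob_space (return A a)" using a by (rule prob_space_return)
  interpret prob_space "return A a" by fact
  have eq: "(\<integral>\<^sup>+ z. g (case z of (x, a) \<Rightarrow> L x a) \<partial>(P \<Otimes>\<^sub>M return A a)) = (\<integral>\<^sup>+ x. g (L x a) \<partial>P)"
    if P: "sets P = sets X" and g: "g \<in> borel_measurable borel" for P and g :: "ereal \<Rightarrow> ennreal"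
  proof -
    have [measurable]: "(\<lambda>z. g (case z of (x, a) \<Rightarrow> L x a)) \<in> borel_measurable (P \<Otimes>\<^sub>M A)"
      using measurable_compose[OF L g] by (simp cong: measurable_cong_sets sets_pair_measure_cong add: P)
    have "(\<integral>\<^sup>+ z. g (case z of (x, a) \<Rightarrow> L x a) \<partial>(P \<Otimes>\<^sub>M return A a))
        = (\<integral>\<^sup>+ x. \<integral>\<^sup>+ y. g (L x y) \<partial>return A a \<partial>P)"
      by (subst nn_integral_fst[symmetric]) (simp_all cong: measurable_cong_sets sets_pair_measure_cong)
    also have "\<dots> = (\<integral>\<^sup>+ x. g (L x a) \<partial>P)"
      using a measurable_compose[OF measurable_Pair1', of _ P "\<lambda>z. g (case z of (x, a) \<Rightarrow> L x a)" A]
      by (intro nn_integral_cong nn_integral_return) auto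
    finally show ?thesis .
  qed
  show ?thesis
    using a prob eq[of _ e2ennreal] eq[of _ "\<lambda>y. e2ennreal (- y)"]
    by (auto simp: randomized_acts_def admissible_dists_def distributions_def ext_defined_def)
qed

lemma rand_loss_return:
  assumes "a \<in> space A" "(\<lambda>a. L x a) \<in> borel_measurable A"
  shows "rand_loss L x (return A a) = L x a"
proof -
  have "enn2ereal (e2ennreal y) - enn2ereal (e2ennreal (- y)) = y" for y
    by (cases "0 \<le> y") (auto simp: e2ennreal_neg enn2ereal_e2ennreal ereal_uminus_le_0_iff zero_ennreal.rep_eq)
  then show ?thesis
    using assms by (simp add: rand_loss_def ext_expectation_def nn_integral_return)
qed

text \<open>The entropy bounds the expected loss of every pure act from below, and averaging over
  acts preserves a constant lower bound. The value \<open>-\<infinity>\<close> is trivial.\<close>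

lemma gen_entropy_le_exp_rand_loss:
  assumes L: "(\<lambda>(x, a). L x a) \<in> borel_measurable (X \<Otimes>\<^sub>M A)"
    and P: "P \<in> distributions X" and \<zeta>: "\<zeta> \<in> distributions A"
    and fin: "gen_entropy A L P \<noteq> \<infinity>"
  shows "gen_entropy A L P \<le> exp_rand_loss L P \<zeta>"
proof (cases "gen_entropy A L P")
  case (real c)
  interpret P: prob_space P using P by (simp add: distributions_def)
  have sets: "sets P = sets X" "sets \<zeta> = sets A"
    using P \<zeta> by (auto simp: distributions_def)
  have "ereal c \<le> exp_loss L P a" if "a \<in> space \<zeta>" for a
    using that sets_eq_imp_space_eq[OF sets(2)] unfolding real[symmetric] gen_entropy_def
    by (auto intro: INF_lower)
  then have "ereal c \<le> ext_expectation (P \<Otimes>\<^sub>M \<zeta>) (\<lambda>(x, a). L x a)"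
    using L \<zeta> by (intro ext_expectation_pair_ge)
      (auto simp: exp_loss_def distributions_def P.sigma_finite_measure_axioms
         cong: measurable_cong_sets sets_pair_measure_cong simp: sets)
  then show ?thesis
    by (simp add: real exp_rand_loss_def)
qed (use fin in auto)

text \<open>The Bayes property controls only the expectation of a difference of losses. Against a
  pure act of finite expected loss, that difference can be split to compare the two
  expectations.\<close>

lemma bayes_act_exp_rand_loss:
  assumes L [measurable]: "(\<lambda>(x, a). L x a) \<in> borel_measurable (X \<Otimes>\<^sub>M A)"
    and P: "P \<in> admissible_dists X A L" and bayes: "bayes_act X A L P \<zeta>"
    and fin: "\<bar>gen_entropy A L P\<bar> \<noteq> \<infinity>"
  shows "exp_rand_loss L P \<zeta> = gen_entropy A L P"
proof (rule antisym)
  have \<zeta>: "\<zeta> \<in> randomized_acts X A L"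
    using bayes by (simp add: bayes_act_def)
  have dist: "P \<in> distributions X" "\<zeta> \<in> distributions A"
    using P \<zeta> by (auto simp: admissible_dists_def randomized_acts_def)
  then have sets: "sets P = sets X" "sets \<zeta> = sets A"
    by (auto simp: distributions_def)
  interpret P: prob_space P using dist by (simp add: distributions_def)
  interpret Z: prob_space \<zeta> using dist by (simp add: distributions_def)
  show "gen_entropy A L P \<le> exp_rand_loss L P \<zeta>"
    using fin by (intro gen_entropy_le_exp_rand_loss[OF L dist]) auto
  have "exp_rand_loss L P \<zeta> \<le> exp_loss L P a" if a: "a \<in> space A" for a
  \<comment> \<open>Acts of infinite expected loss give a trivial bound. Any other act has finite
    expected loss, because the finite entropy bounds it from below.\<close>
  proof (cases "exp_loss L P a = \<infinity>")
    case False
    have "gen_entropy A L P \<le> exp_loss L P a"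
      using a unfolding gen_entropy_def by (rule INF_lower)
    with fin False have u_fin: "\<bar>ext_expectation P (\<lambda>x. L x a)\<bar> \<noteq> \<infinity>"
      by (auto simp: exp_loss_def)
    have rl: "rand_loss L x (return A a) = L x a" if "x \<in> space P" for x
      using that a sets_eq_imp_space_eq[OF sets(1)] measurable_compose[OF measurable_Pair1' L, of x]
      by (intro rand_loss_return) auto
    \<comment> \<open>The loss of \<open>return A a\<close> is identified with \<open>L x a\<close>
      only on the space of \<open>P\<close>, so the transfer goes through a congruence.\<close>
    have cong: "ext_defined P g \<longleftrightarrow> ext_defined P h" "ext_expectation P g = ext_expectation P h"
      if "\<And>x. x \<in> space P \<Longrightarrow> g x = h x" for g h
      using that by (auto simp: ext_defined_def ext_expectation_def cong: nn_integral_cong)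
    have ret: "return A a \<in> randomized_acts X A L"
      using a L by (rule return_in_randomized_acts)
    have d: "ext_defined P (\<lambda>x. L x a - rand_loss L x \<zeta>)"
      "0 \<le> ext_expectation P (\<lambda>x. L x a - rand_loss L x \<zeta>)"
      using bayes ret cong[of "\<lambda>x. rand_loss L x (return A a) - rand_loss L x \<zeta>" "\<lambda>x. L x a - rand_loss L x \<zeta>"]
      by (auto simp: bayes_act_def rl)
    have "ext_expectation (P \<Otimes>\<^sub>M \<zeta>) (\<lambda>(x, a). L x a) \<le> ext_expectation P (\<lambda>x. L x a)"
    proof (rule ext_expectation_pair_le)
      show "(\<lambda>(x, a). L x a) \<in> borel_measurable (P \<Otimes>\<^sub>M \<zeta>)"
        using L by (simp cong: measurable_cong_sets sets_pair_measure_cong add: sets)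
      show "(\<lambda>x. L x a) \<in> borel_measurable P"
        using measurable_compose[OF measurable_Pair2' L, OF a]
        by (simp cong: measurable_cong_sets add: sets)
      show "ext_defined (P \<Otimes>\<^sub>M \<zeta>) (\<lambda>(x, a). L x a)"
        using \<zeta> P by (simp add: randomized_acts_def)
    qed (use d u_fin in \<open>simp_all add: rand_loss_def P.sigma_finite_measure_axioms Z.sigma_finite_measure_axioms\<close>)
    then show ?thesis
      by (simp add: exp_rand_loss_def exp_loss_def)
  qed simp
  then show "exp_rand_loss L P \<zeta> \<le> gen_entropy A L P"
    unfolding gen_entropy_def by (rule INF_greatest)
qed

section \<open>Calculus along the segment and the saddle-point inequalities\<close>

text \<open>The gap between the affine function and \<open>h\<close> has a local minimum at
  \<open>l\<close>, so \<open>h\<close> has the affine slope \<open>v - u\<close> there. A positive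
  slope would make \<open>h\<close> exceed \<open>h l\<close> just to the right of
  \<open>l\<close>.\<close>

lemma affine_touching_above_slope_le_0:
  fixes h :: "real \<Rightarrow> real"
  assumes diff: "h differentiable (at l)"
    and above: "\<forall>\<^sub>F t in nhds l. h t \<le> (1 - t) * u + t * v" and touch: "h l = (1 - l) * u + l * v"
    and right: "\<forall>\<^sub>F t in at_right l. h t \<le> h l"
  shows "v \<le> u"
proof (rule ccontr)
  assume "\<not> v \<le> u"
  obtain D where D: "(h has_real_derivative D) (at l)"
    using diff real_differentiable_def by blast
  define k where "k t = (1 - t) * u + t * v - h t" for t
  have k: "(k has_real_derivative v - u - D) (at l)"
    unfolding k_def by (rule derivative_eq_intros D refl | simp)+
  obtain d where "0 < d" and d: "\<And>t. dist t l < d \<Longrightarrow> h t \<le> (1 - t) * u + t * v"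
    using above unfolding eventually_nhds_metric by auto
  have "v - u - D = 0"
    using \<open>0 < d\<close> by (rule DERIV_local_min[OF k])
      (use d touch in \<open>auto simp: k_def dist_real_def abs_minus_commute\<close>)
  with \<open>\<not> v \<le> u\<close> have "0 < D" by simp
  then obtain e where "0 < e" and e: "\<And>s. 0 < s \<Longrightarrow> s < e \<Longrightarrow> h l < h (l + s)"
    using DERIV_pos_inc_right[OF D] by auto
  obtain b where "l < b" and b: "\<And>t. l < t \<Longrightarrow> t < b \<Longrightarrow> h t \<le> h l"
    using right unfolding eventually_at_right_field by auto
  \<comment> \<open>Half the smaller of the two radii, so that \<open>l + s\<close> lies in both
    right neighbourhoods.\<close>
  define s where "s = min e (b - l) / 2"
  have "0 < s" "s < e" "l + s < b"
    using \<open>0 < e\<close> \<open>l < b\<close> by (auto simp: s_def min_def field_simps)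
  with e[of s] b[of "l + s"] show False by simp
qed

theorem theorem6p2:
  fixes A :: "'a measure"
    and L :: "'x::metric_space \<Rightarrow> 'a \<Rightarrow> ereal"
    and \<Gamma> :: "'x measure set"
    and P\<^sub>s :: "'x measure" and \<zeta>\<^sub>s :: "'a measure"
  assumes game: "basic_game borel A L"
    and \<Gamma>_sub: "\<Gamma> \<subseteq> admissible_dists borel A L"
    and \<Gamma>_convex: "convex_dists \<Gamma>"
    and P\<^sub>s_in: "P\<^sub>s \<in> \<Gamma>"
    and bayes: "bayes_act borel A L P\<^sub>s \<zeta>\<^sub>s"
    and H_max: "gen_entropy A L P\<^sub>s = (SUP P\<in>\<Gamma>. gen_entropy A L P)"
    and H_finite: "- \<infinity> < gen_entropy A L P\<^sub>s" "gen_entropy A L P\<^sub>s < \<infinity>"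
    and smooth: "\<And>P. P \<in> \<Gamma> \<Longrightarrow>
      \<exists>P\<^sub>0\<in>admissible_dists borel A L. \<exists>l\<in>{0<..<1}.
        P\<^sub>s = mixture l P\<^sub>0 P \<and>
        ereal_differentiable_at (\<lambda>t. gen_entropy A L (mixture t P\<^sub>0 P)) l"
  shows "saddle_point borel A L \<Gamma> P\<^sub>s \<zeta>\<^sub>s"
proof -
  have L: "(\<lambda>(x, a). L x a) \<in> borel_measurable (borel \<Otimes>\<^sub>M A)"
    using game by (rule basic_game.measurable_L)
  have fin: "\<bar>gen_entropy A L P\<^sub>s\<bar> \<noteq> \<infinity>"
    using H_finite by auto
  have \<zeta>\<^sub>s: "\<zeta>\<^sub>s \<in> randomized_acts borel A L"
    using bayes by (simp add: bayes_act_def)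
  have dist: "P \<in> distributions borel" if "P \<in> admissible_dists borel A L" for P
    using that by (simp add: admissible_dists_def)
  have dist\<zeta>: "\<zeta> \<in> distributions A" if "\<zeta> \<in> randomized_acts borel A L" for \<zeta>
    using that by (simp add: randomized_acts_def)
  have P\<^sub>s_adm: "P\<^sub>s \<in> admissible_dists borel A L"
    using \<Gamma>_sub P\<^sub>s_in by auto
  have val: "exp_rand_loss L P\<^sub>s \<zeta>\<^sub>s = gen_entropy A L P\<^sub>s"
    using L P\<^sub>s_adm bayes fin by (rule bayes_act_exp_rand_loss)
  have "exp_rand_loss L P \<zeta>\<^sub>s \<le> exp_rand_loss L P\<^sub>s \<zeta>\<^sub>s" if P: "P \<in> \<Gamma>" for P
  proof -
    obtain P\<^sub>0 l where P\<^sub>0: "P\<^sub>0 \<in> admissible_dists borel A L" and l: "0 < l" "l < 1"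
      and mix: "P\<^sub>s = mixture l P\<^sub>0 P"
      and diff: "ereal_differentiable_at (\<lambda>t. gen_entropy A L (mixture t P\<^sub>0 P)) l"
      using smooth[OF P] by auto
    have P_dist: "P \<in> distributions borel"
      using P \<Gamma>_sub by (auto intro: dist)
    have Q_dist: "mixture t P\<^sub>0 P \<in> distributions borel" if "0 \<le> t" "t \<le> 1" for t
      using that dist[OF P\<^sub>0] P_dist by (auto simp: distributions_def intro: prob_space_mixture)
    have sets: "sets P = sets P\<^sub>0" "sets P\<^sub>0 = sets borel" "sets \<zeta>\<^sub>s = sets A" and "prob_space \<zeta>\<^sub>s"
      using dist[OF P\<^sub>0] P_dist dist\<zeta>[OF \<zeta>\<^sub>s] by (auto simp: distributions_def)
    interpret Z: prob_space \<zeta>\<^sub>s by fact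
    have "(\<lambda>(x, a). L x a) \<in> borel_measurable (P\<^sub>0 \<Otimes>\<^sub>M \<zeta>\<^sub>s)"
      using L by (simp cong: measurable_cong_sets sets_pair_measure_cong add: sets)
    \<comment> \<open>The mixture at \<open>l\<close> is \<open>P\<^sub>s\<close>, whose expected
      loss under \<open>\<zeta>\<^sub>s\<close> equals its finite entropy.\<close>
    moreover have "\<bar>ext_expectation (mixture l P\<^sub>0 P \<Otimes>\<^sub>M \<zeta>\<^sub>s) (\<lambda>(x, a). L x a)\<bar> \<noteq> \<infinity>"
      using fin by (simp flip: val mix exp_rand_loss_def)
    ultimately obtain u v where v: "exp_rand_loss L P \<zeta>\<^sub>s = ereal v"
      and uv: "\<And>t. 0 \<le> t \<Longrightarrow> t \<le> 1 \<Longrightarrow>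
        exp_rand_loss L (mixture t P\<^sub>0 P) \<zeta>\<^sub>s = ereal ((1 - t) * u + t * v)"
      using l sets(1) Z.sigma_finite_measure_axioms unfolding exp_rand_loss_def
      by (elim ext_expectation_mixture_pair_affine) auto
    \<comment> \<open>\<open>real_of_ereal\<close> sends infinite values to \<open>0\<close>, so
      \<open>h\<close> represents the entropy only where it is finite;
      \<open>ereal_differentiable_at\<close> guarantees this near \<open>l\<close>.\<close>
    define h where "h t = real_of_ereal (gen_entropy A L (mixture t P\<^sub>0 P))" for t
    have h: "\<forall>\<^sub>F t in nhds l. gen_entropy A L (mixture t P\<^sub>0 P) = ereal (h t)"
      using diff unfolding ereal_differentiable_at_def
      by (auto simp: h_def ereal_real elim: eventually_mono)
    have hl: "gen_entropy A L P\<^sub>s = ereal (h l)"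
      using fin by (simp add: h_def mix ereal_real)
    have touch: "h l = (1 - l) * u + l * v"
      using val hl uv[of l] l by (simp add: mix)
    have "v \<le> u"
    proof (rule affine_touching_above_slope_le_0[where h = h and l = l])
      show "h differentiable (at l)"
        using diff by (simp add: ereal_differentiable_at_def h_def[abs_def])
      show "h l = (1 - l) * u + l * v" by (fact touch)
      have inside: "\<forall>\<^sub>F t in nhds l. t \<in> {0<..<1}"
        using l by (intro eventually_nhds_in_open) auto
      show "\<forall>\<^sub>F t in nhds l. h t \<le> (1 - t) * u + t * v"
        using h inside
      proof eventually_elim
        case (elim t)
        then have "gen_entropy A L (mixture t P\<^sub>0 P) \<le> exp_rand_loss L (mixture t P\<^sub>0 P) \<zeta>\<^sub>s"
          by (intro gen_entropy_le_exp_rand_loss[OF L Q_dist dist\<zeta>[OF \<zeta>\<^sub>s]]) auto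
        with elim uv[of t] show ?case by simp
      qed
      have "\<forall>\<^sub>F t in nhds l. l < t \<longrightarrow> h t \<le> h l"
        using h inside
      proof eventually_elim
        case (elim t)
        show ?case
        proof
          assume "l < t"
          \<comment> \<open>For \<open>l < t < 1\<close> the mixture at \<open>t\<close> lies
            between \<open>P\<^sub>s\<close> and \<open>P\<close>, both in \<open>\<Gamma>\<close>;
            the weight comes from \<open>mixture_mixture\<close>. Membership of
            \<open>P\<^sub>0\<close> in \<open>\<Gamma>\<close> is not assumed, so only this side of
            \<open>l\<close> is controlled.\<close>
          have "mixture ((t - l) / (1 - l)) P\<^sub>s P \<in> \<Gamma>"
            using \<Gamma>_convex P\<^sub>s_in P elim l \<open>l < t\<close> by (auto simp: convex_dists_def)
          then have "mixture t P\<^sub>0 P \<in> \<Gamma>"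
            using mixture_mixture[OF sets(1), of l t] elim l \<open>l < t\<close> by (simp add: mix)
          then have "gen_entropy A L (mixture t P\<^sub>0 P) \<le> gen_entropy A L P\<^sub>s"
            unfolding H_max by (rule SUP_upper)
          with elim hl show "h t \<le> h l" by simp
        qed
      qed
      then show "\<forall>\<^sub>F t in at_right l. h t \<le> h l"
        by (auto simp: eventually_at_filter elim: eventually_mono)
    qed
    \<comment> \<open>The right side is the value at \<open>P\<^sub>s\<close>, a convex combination
      of \<open>u\<close> and \<open>v\<close>, and therefore at least the smaller endpoint value
      \<open>v\<close>.\<close>
    then have "v \<le> (1 - l) * u + l * v"
      using mult_left_mono[of v u "1 - l"] l by (simp add: algebra_simps)
    then show ?thesis
      using v val hl touch by simp
  qed
  \<comment> \<open>Optimality of \<open>\<zeta>\<^sub>s\<close> among randomized acts: its loss at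
    \<open>P\<^sub>s\<close> equals the entropy, which bounds the loss of every randomized act from
    below.\<close>
  moreover have "exp_rand_loss L P\<^sub>s \<zeta>\<^sub>s \<le> exp_rand_loss L P\<^sub>s \<zeta>" if "\<zeta> \<in> randomized_acts borel A L" for \<zeta>
    unfolding val using fin
    by (intro gen_entropy_le_exp_rand_loss[OF L dist[OF P\<^sub>s_adm] dist\<zeta>[OF that]]) auto
  ultimately show ?thesis
    using P\<^sub>s_in \<zeta>\<^sub>s fin by (simp add: saddle_point_def val)
qed

end
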